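(* Let $G$ be a graph and let $H$ be a connected graph created from $G$ by the IIM process, i.e. $H\in\mathcal{IIM}_l(G)$ for some $l$, such that at least one vertex of $H$ was added as an anticlone (that is, $H\in \mathcal{IIM}_l(G)\setminus\{ILT_l(G)\}$, where $ILT_l(G)$ is the graph resulting from choosing to clone at every vertex in every time step). Then $$b(H)\le 4.$$
   Context: Graphs are finite, simple, undirected and have at least one vertex. For a vertex $v$ of a graph $F$, $N(v)$ is its neighborhood and $N[v]=N(v)\cup\{v\}$; for a set $B$ of vertices, $N[B]=\bigcup_{v\in B}N[v]$. A new vertex $v'$ added to $F$ is a clone of $v\in V(F)$ if $N(v')=N[v]$, and an anticlone of $v$ if $N(v')=V(F)\setminus N[v]$. IIM process: start with $G_0=G$. At each time step $t\ge1$, $G_t$ is obtained from $G_{t-1}$ by simultaneously adding, for each vertex $v$ of $G_{t-1}$, exactly one new vertex which is either a clone or an anticlone of $v$ (with respect to $G_{t-1}$), the choice being made independently for each $v$; vertices added in the same time step are pairwise non-adjacent. $\mathcal{IIM}_l(G)$ is the family of all graphs $G_l$ that can arise after $l$ time steps. $ILT_l(G)$ is the one obtained when every choice is to clone. Graph burning: all vertices of a graph start unburned ($B_0=\emptyset$). At each time step $t\ge 1$ the fire first spreads to all neighbors of burned vertices and then a new source vertex $v_t$ is chosen and burned, so $B_{t}=N[B_{t-1}]\cup\{v_{t}\}$ (in particular $B_1=\{v_1\}$). The burning number $b(F)$ of a graph $F$ is the minimum number $t$ of time steps for which sources can be chosen so that $B_t=V(F)$. *)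

theory Defs
  imports "Graph_Theory.Digraph_Component"
begin

text \<open>
  Finite simple undirected graphs are digraphs satisfying \<^locale>\<open>pair_graph\<close>: finite,
  loop-free, without parallel arcs, and symmetric. This locale permits the empty vertex set.
\<close>

definition nbhd :: "'a pair_pre_digraph \<Rightarrow> 'a \<Rightarrow> 'a set" where
  "nbhd F v = {u. (v, u) \<in> parcs F}"

definition closed_nbhd :: "'a pair_pre_digraph \<Rightarrow> 'a \<Rightarrow> 'a set" where
  "closed_nbhd F v = insert v (nbhd F v)"

text \<open>Below, \<open>F\<close> is the graph before a time step, \<open>H\<close> the graph after it, and \<open>v'\<close> a new vertex.\<close>

definition clone_of :: "'a pair_pre_digraph \<Rightarrow> 'a pair_pre_digraph \<Rightarrow> 'a \<Rightarrow> 'a \<Rightarrow> bool" where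
  "clone_of F H v v' \<longleftrightarrow> v' \<in> pverts H - pverts F \<and> nbhd H v' = closed_nbhd F v"

definition anticlone_of :: "'a pair_pre_digraph \<Rightarrow> 'a pair_pre_digraph \<Rightarrow> 'a \<Rightarrow> 'a \<Rightarrow> bool" where
  "anticlone_of F H v v' \<longleftrightarrow>
     v' \<in> pverts H - pverts F \<and> nbhd H v' = pverts F - closed_nbhd F v"

text \<open>
  \<open>f v\<close> is the vertex added for \<open>v\<close>. That the new vertices are pairwise non-adjacent is not
  stated separately: the neighborhood of a clone or anticlone in \<open>H\<close> lies in \<open>pverts F\<close>.
\<close>

definition iim_step ::
    "'a pair_pre_digraph \<Rightarrow> ('a \<Rightarrow> 'a) \<Rightarrow> 'a pair_pre_digraph \<Rightarrow> bool" where
  "iim_step F f H \<longleftrightarrow>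
     pair_graph H \<and> induced_subgraph F H \<and>
     bij_betw f (pverts F) (pverts H - pverts F) \<and>
     (\<forall>v \<in> pverts F. clone_of F H v (f v) \<or> anticlone_of F H v (f v))"

definition iim_process ::
    "'a pair_pre_digraph \<Rightarrow> nat \<Rightarrow> (nat \<Rightarrow> 'a pair_pre_digraph) \<Rightarrow> (nat \<Rightarrow> 'a \<Rightarrow> 'a) \<Rightarrow> bool" where
  "iim_process G l Gs f \<longleftrightarrow> Gs 0 = G \<and> (\<forall>t<l. iim_step (Gs t) (f t) (Gs (Suc t)))"

definition adds_anticlone ::
    "nat \<Rightarrow> (nat \<Rightarrow> 'a pair_pre_digraph) \<Rightarrow> (nat \<Rightarrow> 'a \<Rightarrow> 'a) \<Rightarrow> bool" where
  "adds_anticlone l Gs f \<longleftrightarrow>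
     (\<exists>t<l. \<exists>v \<in> pverts (Gs t). anticlone_of (Gs t) (Gs (Suc t)) v (f t v))"

text \<open>
  The names of new vertices are arbitrary, so \<open>ILT l G\<close>, a single graph up to isomorphism,
  is the set of all its realizations on the given vertex type.
\<close>

definition IIM :: "nat \<Rightarrow> 'a pair_pre_digraph \<Rightarrow> 'a pair_pre_digraph set" where
  "IIM l G = {H. \<exists>Gs f. iim_process G l Gs f \<and> Gs l = H}"

definition ILT :: "nat \<Rightarrow> 'a pair_pre_digraph \<Rightarrow> 'a pair_pre_digraph set" where
  "ILT l G = {H. \<exists>Gs f. iim_process G l Gs f \<and> Gs l = H \<and>
     (\<forall>t<l. \<forall>v \<in> pverts (Gs t). clone_of (Gs t) (Gs (Suc t)) v (f t v))}"

lemma IIM_not_ILT_adds_anticlone: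
  assumes "H \<in> IIM l G - ILT l G"
  shows "\<exists>Gs f. iim_process G l Gs f \<and> Gs l = H \<and> adds_anticlone l Gs f"
  using assms unfolding IIM_def ILT_def adds_anticlone_def iim_process_def iim_step_def by blast

text \<open>\<open>burned F s t\<close> is the set of burned vertices after \<open>t\<close> steps with sources \<open>s 1, s 2, \<dots>\<close>.\<close>

primrec burned :: "'a pair_pre_digraph \<Rightarrow> (nat \<Rightarrow> 'a) \<Rightarrow> nat \<Rightarrow> 'a set" where
  "burned F s 0 = {}"
| "burned F s (Suc t) = (\<Union>v \<in> burned F s t. closed_nbhd F v) \<union> {s (Suc t)}"

text \<open>For finite nonempty \<open>F\<close> such a \<open>t\<close> exists: use every vertex as a source once.\<close>

definition burning_number :: "'a pair_pre_digraph \<Rightarrow> nat" where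
  "burning_number F =
     (LEAST t. \<exists>s. (\<forall>i \<in> {1..t}. s i \<in> pverts F) \<and> burned F s t = pverts F)"

end

theory Submission
  imports Defs
begin

text \<open>
  An anticlone brings every vertex close to one of two centers. If \<open>v'\<close> is added to \<open>F\<close> as an anticlone of \<open>v\<close>, then
  \<open>N[v]\<close> and \<open>N[v']\<close> together contain every old vertex. Every new vertex has only old neighbors
  and, if the new graph \<open>H\<close> is connected, has at least one; so the balls of radius 2 around \<open>v\<close>
  and \<open>v'\<close> cover \<open>H\<close> (\<open>two_centers_anticlone\<close>). A burning whose first two sources are
  \<open>v\<close> and \<open>v'\<close> burns the balls of radius 3 and 2 around them in four steps.

  It remains to pass from the last time step that adds an anticlone to the final graph. All later
  steps clone every vertex, and a clone of \<open>u\<close> is adjacent to everything that dominates \<open>u\<close>,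
  so the two centers keep working (\<open>two_centers_clone\<close>). In the other direction, connectedness
  of the final graph is pulled back along the clone steps, since merging each clone with its
  original maps edges to edges or points (\<open>uncut_before_clone\<close>).
\<close>

definition spread :: "'a pair_pre_digraph \<Rightarrow> 'a set \<Rightarrow> 'a set" where
  "spread F A = (\<Union>v \<in> A. closed_nbhd F v)"

definition two_centers :: "'a pair_pre_digraph \<Rightarrow> bool" where
  "two_centers F \<longleftrightarrow> (\<exists>x \<in> pverts F. \<exists>y \<in> pverts F. spread F (spread F {x, y}) = pverts F)"

text \<open>
  Connectedness as the absence of a nontrivial vertex set without outgoing edges: in this
  form it applies directly to a single vertex, which cannot be isolated, and to a vertex set
  together with its clones, so that no walks have to be projected.
\<close>

definition uncut :: "'a pair_pre_digraph \<Rightarrow> bool" where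
  "uncut F \<longleftrightarrow> (\<forall>S \<subseteq> pverts F. S \<noteq> {} \<and> (\<forall>(x, y) \<in> parcs F. x \<in> S \<longrightarrow> y \<in> S) \<longrightarrow> S = pverts F)"

lemma pair_graph_arc_sym:
  assumes "pair_graph F" "(x, y) \<in> parcs F"
  shows "(y, x) \<in> parcs F"
proof -
  interpret pair_graph F by fact
  show ?thesis using assms(2) arcs_symmetric by blast
qed

lemma pair_graph_arc_verts:
  assumes "pair_graph F" "(x, y) \<in> parcs F"
  shows "x \<in> pverts F" "y \<in> pverts F"
proof -
  interpret pair_graph F by fact
  show "x \<in> pverts F" "y \<in> pverts F" using assms(2) by (auto dest: in_arcsD1 in_arcsD2)
qed

lemma spread_subset_pverts:
  assumes "pair_graph F" "A \<subseteq> pverts F"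
  shows "spread F A \<subseteq> pverts F"
  using assms pair_graph_arc_verts[OF assms(1)]
  by (auto simp: spread_def closed_nbhd_def nbhd_def)

lemma subset_spread: "A \<subseteq> spread F A"
  by (auto simp: spread_def closed_nbhd_def)

lemma spread_mono: "A \<subseteq> B \<Longrightarrow> spread F A \<subseteq> spread F B"
  by (auto simp: spread_def)

lemma burned_Suc_spread: "burned F s (Suc t) = insert (s (Suc t)) (spread F (burned F s t))"
  by (simp add: spread_def)

lemma two_centers_burning_number:
  assumes "pair_graph F" "two_centers F"
  shows "burning_number F \<le> 4"
proof -
  obtain x y where xy: "x \<in> pverts F" "y \<in> pverts F"
    and cover: "spread F (spread F {x, y}) = pverts F"
    using assms(2) by (auto simp: two_centers_def)
  \<comment> \<open>The first source has three steps left to spread and the second has two, which is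
    what the two balls of radius 2 need.\<close>
  define s where "s = (\<lambda>i::nat. if i = 2 then y else x)"
  have s: "s i \<in> pverts F" for i using xy by (simp add: s_def)
  have inside: "burned F s t \<subseteq> pverts F" for t
  proof (induction t)
    case (Suc t)
    then show ?case
      using s spread_subset_pverts[OF assms(1)] by (simp add: burned_Suc_spread del: burned.simps(2))
  qed simp
  have "{x} \<subseteq> burned F s 1" by (simp add: s_def)
  then have "{x, y} \<subseteq> burned F s 2"
    using subset_spread[of "burned F s 1" F] burned_Suc_spread[of F s 1]
    by (auto simp: s_def numeral_2_eq_2)
  then have "spread F {x, y} \<subseteq> burned F s 3"
    using burned_Suc_spread[of F s 2] spread_mono[of "{x, y}" "burned F s 2" F]
    by (auto simp: numeral_3_eq_3 numeral_2_eq_2)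
  then have "spread F (spread F {x, y}) \<subseteq> burned F s 4"
    using burned_Suc_spread[of F s 3] spread_mono[of "spread F {x, y}" "burned F s 3" F] by auto
  then have "burned F s 4 = pverts F" using inside cover by blast
  then show ?thesis
    unfolding burning_number_def using s by (intro Least_le) blast
qed

lemma connected_uncut:
  assumes "pair_graph H" "connected H"
  shows "uncut H"
  unfolding uncut_def
proof (intro allI impI, elim conjE)
  fix S assume S: "S \<subseteq> pverts H" "S \<noteq> {}" and closed: "\<forall>(x, y) \<in> parcs H. x \<in> S \<longrightarrow> y \<in> S"
  interpret pair_graph H by fact
  obtain x where x: "x \<in> S" using S by blast
  have "y \<in> S" if "y \<in> pverts H" for y
  proof -
    have "x \<rightarrow>\<^sup>*\<^bsub>with_proj H\<^esub> y"
      using assms(2) x S that reachable_mk_symmetric_eq[OF sym_arcs]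
      by (auto simp: connected_def strongly_connected_def)
    then show ?thesis
    proof (induction rule: reachable_induct)
      case base
      show ?case by (rule x)
    next
      case (step y z)
      then show ?case using closed by auto
    qed
  qed
  then show "S = pverts H" using S by blast
qed

lemma iim_step_induced_arcs:
  assumes "iim_step F f H" "x \<in> pverts F" "y \<in> pverts F"
  shows "(x, y) \<in> parcs F \<longleftrightarrow> (x, y) \<in> parcs H"
  using assms by (auto simp: iim_step_def induced_subgraph_def)

lemma iim_step_pverts:
  assumes "iim_step F f H"
  shows "pverts H = pverts F \<union> f ` pverts F" "f ` pverts F \<inter> pverts F = {}"
proof -
  have sub: "pverts F \<subseteq> pverts H"
    using assms by (auto simp: iim_step_def induced_subgraph_def subgraph_def)
  have im: "f ` pverts F = pverts H - pverts F"
    using assms by (auto simp: iim_step_def bij_betw_def)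
  show "pverts H = pverts F \<union> f ` pverts F" "f ` pverts F \<inter> pverts F = {}"
    unfolding im using sub by auto
qed

lemma iim_step_spread_mono:
  assumes "iim_step F f H"
  shows "spread F A \<subseteq> spread H A"
proof -
  have "parcs F \<subseteq> parcs H"
    using assms by (auto simp: iim_step_def induced_subgraph_def)
  then show ?thesis by (auto simp: spread_def closed_nbhd_def nbhd_def)
qed

text \<open>
  No two new vertices are adjacent, so once none of them is isolated the old vertices dominate;
  and the closed neighborhoods of \<open>v\<close> and its anticlone contain all old vertices.
\<close>

lemma two_centers_anticlone:
  assumes F: "pair_graph F" and step: "iim_step F f H" and H: "uncut H"
    and v: "v \<in> pverts F" and anti: "anticlone_of F H v (f v)"
  shows "two_centers H"
proof -
  note verts = iim_step_pverts[OF step]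
  have pgH: "pair_graph H" using step by (simp add: iim_step_def)
  have centers: "v \<in> pverts H" "f v \<in> pverts H" "f v \<noteq> v" using v verts by auto
  have old: "pverts F \<subseteq> spread H {v, f v}"
  proof
    fix u assume u: "u \<in> pverts F"
    show "u \<in> spread H {v, f v}"
    proof (cases "u \<in> closed_nbhd F v")
      case True
      then show ?thesis using iim_step_spread_mono[OF step, of "{v}"] by (auto simp: spread_def)
    next
      case False
      then have "u \<in> nbhd H (f v)" using u anti by (auto simp: anticlone_of_def)
      then show ?thesis by (simp add: spread_def closed_nbhd_def)
    qed
  qed
  have "w \<in> spread H (pverts F)" if w: "w \<in> pverts H" for w
  proof (cases "w \<in> pverts F")
    case True
    then show ?thesis using subset_spread[of "pverts F" H] by blast
  next
    case False
    then obtain u where u: "u \<in> pverts F" "w = f u" using w verts by blast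
    have "{w} \<noteq> pverts H" using centers by (metis singletonD)
    then have "\<not> (\<forall>(x, y) \<in> parcs H. x \<in> {w} \<longrightarrow> y \<in> {w})"
      using H[unfolded uncut_def, rule_format, of "{w}"] w by blast
    then obtain y where y: "(w, y) \<in> parcs H" by auto
    have "closed_nbhd F u \<subseteq> pverts F"
      using u spread_subset_pverts[OF F, of "{u}"] by (simp add: spread_def)
    moreover have "clone_of F H u (f u) \<or> anticlone_of F H u (f u)"
      using step u by (simp add: iim_step_def)
    ultimately have "nbhd H (f u) \<subseteq> pverts F"
      by (auto simp: clone_of_def anticlone_of_def)
    then have "y \<in> pverts F" using y u by (auto simp: nbhd_def)
    then show ?thesis
      using pair_graph_arc_sym[OF pgH y] by (auto simp: spread_def closed_nbhd_def nbhd_def)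
  qed
  then have "pverts H \<subseteq> spread H (spread H {v, f v})" using spread_mono[OF old, of H] by blast
  moreover have "spread H (spread H {v, f v}) \<subseteq> pverts H"
    using centers by (intro spread_subset_pverts pgH) auto
  ultimately show ?thesis using centers unfolding two_centers_def by blast
qed

text \<open>
  A vertex that equals \<open>u\<close> or is adjacent to it is adjacent to the clone of \<open>u\<close>. Hence the old
  ball of radius 1 around the centers, which dominates \<open>F\<close>, also dominates \<open>H\<close>.
\<close>

lemma two_centers_clone:
  assumes F: "pair_graph F" and step: "iim_step F f H"
    and clones: "\<forall>v \<in> pverts F. clone_of F H v (f v)" and two: "two_centers F"
  shows "two_centers H"
proof -
  note verts = iim_step_pverts[OF step]
  have pgH: "pair_graph H" using step by (simp add: iim_step_def)
  obtain x y where xy: "x \<in> pverts F" "y \<in> pverts F"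
    and cover: "spread F (spread F {x, y}) = pverts F"
    using two by (auto simp: two_centers_def)
  let ?A = "spread F {x, y}"
  have "w \<in> spread H ?A" if w: "w \<in> pverts H" for w
  proof (cases "w \<in> pverts F")
    case True
    then show ?thesis using cover iim_step_spread_mono[OF step, of ?A] by blast
  next
    case False
    then obtain u where u: "u \<in> pverts F" "w = f u" using w verts(1) by blast
    then have "u \<in> spread F ?A" using cover by simp
    then obtain a where a: "a \<in> ?A" "u \<in> closed_nbhd F a"
      unfolding spread_def[of F ?A] by blast
    then have "a \<in> closed_nbhd F u"
      using pair_graph_arc_sym[OF F, of a u] by (auto simp: closed_nbhd_def nbhd_def)
    then have "(f u, a) \<in> parcs H" using clones u by (auto simp: clone_of_def nbhd_def)
    then have "w \<in> closed_nbhd H a"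
      using u(2) pair_graph_arc_sym[OF pgH] by (simp add: closed_nbhd_def nbhd_def)
    then show ?thesis using a(1) unfolding spread_def[of H] by blast
  qed
  then have "pverts H \<subseteq> spread H (spread H {x, y})"
    using spread_mono[OF iim_step_spread_mono[OF step, of "{x, y}"], of H] by blast
  moreover have "spread H (spread H {x, y}) \<subseteq> pverts H"
    using xy verts by (intro spread_subset_pverts pgH) auto
  ultimately show ?thesis using xy verts unfolding two_centers_def by blast
qed

text \<open>
  Merging each clone with its original sends every edge of \<open>H\<close> to an edge of \<open>F\<close> or to a single
  vertex, so a separation of \<open>F\<close> would lift to a separation of \<open>H\<close>.
\<close>

lemma uncut_before_clone:
  assumes F: "pair_graph F" and step: "iim_step F f H"
    and clones: "\<forall>v \<in> pverts F. clone_of F H v (f v)" and H: "uncut H"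
  shows "uncut F"
  unfolding uncut_def
proof (intro allI impI, elim conjE)
  fix S
  assume S: "S \<subseteq> pverts F" "S \<noteq> {}" and closed: "\<forall>(x, y) \<in> parcs F. x \<in> S \<longrightarrow> y \<in> S"
  note verts = iim_step_pverts[OF step]
  have pgH: "pair_graph H" using step by (simp add: iim_step_def)
  have clone_nbhd: "(f u, y) \<in> parcs H \<longleftrightarrow> y = u \<or> (u, y) \<in> parcs F" if "u \<in> pverts F" for u y
    using clones that by (auto simp: clone_of_def closed_nbhd_def nbhd_def)
  \<comment> \<open>The preimage of \<open>S\<close> under the map that merges each clone with its original.\<close>
  let ?T = "S \<union> f ` S"
  have "y \<in> ?T" if xy: "(x, y) \<in> parcs H" and x: "x \<in> ?T" for x y
  proof (cases "x \<in> S")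
    case True
    show ?thesis
    proof (cases "y \<in> pverts F")
      case y: True
      then have "(x, y) \<in> parcs F" using True S xy iim_step_induced_arcs[OF step] by blast
      then show ?thesis using closed True by auto
    next
      case False
      then obtain u where u: "u \<in> pverts F" "y = f u"
        using pair_graph_arc_verts[OF pgH xy] verts by blast
      then have "x = u \<or> (u, x) \<in> parcs F"
        using clone_nbhd pair_graph_arc_sym[OF pgH xy] by blast
      then have "u \<in> S" using pair_graph_arc_sym[OF F] closed True by blast
      then show ?thesis using u by blast
    qed
  next
    case False
    then obtain u where u: "u \<in> S" "x = f u" using x by blast
    then have "y = u \<or> (u, y) \<in> parcs F" using clone_nbhd[of u y] S(1) xy by auto
    then show ?thesis using u closed by auto
  qed
  then have "\<forall>(x, y) \<in> parcs H. x \<in> ?T \<longrightarrow> y \<in> ?T" by auto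
  moreover have "?T \<subseteq> pverts H" "?T \<noteq> {}" using S verts(1) by auto
  ultimately have "?T = pverts H" using H[unfolded uncut_def, rule_format, of ?T] by blast
  then have "pverts F \<subseteq> S \<union> f ` S" using verts(1) by auto
  moreover have "f ` S \<inter> pverts F = {}" using verts(2) S(1) by auto
  ultimately show "S = pverts F" using S(1) by auto
qed

lemma iim_process_pair_graph:
  assumes "pair_graph G" "iim_process G l Gs f"
  shows "pair_graph (Gs l)"
  using assms by (cases l) (auto simp: iim_process_def iim_step_def)

text \<open>
  The induction goes down from the final graph through clone-only steps, carrying connectedness
  along, until it meets the last step that adds an anticlone.
\<close>

lemma iim_process_two_centers:
  assumes "pair_graph G" "iim_process G l Gs f" "adds_anticlone l Gs f" "uncut (Gs l)"
  shows "two_centers (Gs l)"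
  using assms(2-)
proof (induction l)
  case 0
  then show ?case by (simp add: adds_anticlone_def)
next
  case (Suc l)
  have proc: "iim_process G l Gs f" and step: "iim_step (Gs l) (f l) (Gs (Suc l))"
    using Suc.prems(1) by (auto simp: iim_process_def)
  have pg: "pair_graph (Gs l)" by (rule iim_process_pair_graph[OF assms(1) proc])
  show ?case
  proof (cases "\<exists>v \<in> pverts (Gs l). anticlone_of (Gs l) (Gs (Suc l)) v (f l v)")
    case True
    then show ?thesis using two_centers_anticlone[OF pg step] Suc.prems(3) by blast
  next
    case False
    then have clones: "\<forall>v \<in> pverts (Gs l). clone_of (Gs l) (Gs (Suc l)) v (f l v)"
      using step by (auto simp: iim_step_def)
    have "adds_anticlone l Gs f"
      using Suc.prems(2) False by (auto simp: adds_anticlone_def less_Suc_eq)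
    moreover have "uncut (Gs l)" by (rule uncut_before_clone[OF pg step clones Suc.prems(3)])
    ultimately have "two_centers (Gs l)" using Suc.IH proc by blast
    then show ?thesis by (rule two_centers_clone[OF pg step clones])
  qed
qed

theorem theorem5p1:
  fixes G H :: "'a pair_pre_digraph"
    and Gs :: "nat \<Rightarrow> 'a pair_pre_digraph"
    and f :: "nat \<Rightarrow> 'a \<Rightarrow> 'a"
    and l :: nat
  assumes "pair_graph G" and "pverts G \<noteq> {}"
    and "iim_process G l Gs f" and "H = Gs l"
    and "connected H"
    and "adds_anticlone l Gs f"
  shows "burning_number H \<le> 4"
proof -
  have pg: "pair_graph (Gs l)" by (rule iim_process_pair_graph[OF assms(1,3)])
  have "uncut (Gs l)" using connected_uncut[OF pg] assms(4,5) by simp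
  then have "two_centers (Gs l)" by (rule iim_process_two_centers[OF assms(1,3,6)])
  then show ?thesis using two_centers_burning_number[OF pg] assms(4) by simp
qed

end
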